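(* Let $t\geq 3$ and let $\mathcal{C}_1,\mathcal{C}_2\subseteq\mathbb{Z}_4^{\beta}$ be any two quaternary linear perfect codes of length $\beta=2^{t-1}$. Then $\eta(\mathcal{C}_1,\mathcal{C}_2)=|\mathcal{C}_1\cap\mathcal{C}_2|$ satisfies $$2^{2\beta-2t}\leq\eta(\mathcal{C}_1,\mathcal{C}_2)\leq 2^{2\beta-t-1}.$$
   Context: A quaternary linear code of length $\beta$ is a subgroup $\mathcal{C}$ of $\mathbb{Z}_4^{\beta}$. Its dual is $\mathcal{C}^\perp=\{u\in\mathbb{Z}_4^\beta:\sum_j u_jv_j=0\in\mathbb{Z}_4 \text{ for all } v\in\mathcal{C}\}$. The Gray map $\phi:\mathbb{Z}_4^{\beta}\to\mathbb{Z}_2^{2\beta}$ applies coordinatewise $0\mapsto(0,0),\ 1\mapsto(0,1),\ 2\mapsto(1,1),\ 3\mapsto(1,0)$. A quaternary linear perfect code of length $\beta=2^{t-1}$ is a quaternary linear code $\mathcal{C}\subseteq\mathbb{Z}_4^\beta$ such that $\phi(\mathcal{C})$ has the parameters of an extended perfect binary code: length $2^t$, $2^{2^t-t-1}$ codewords, minimum Hamming distance $4$. Standing convention: the all-ones vector $(1,\ldots,1)\in\mathbb{Z}_4^\beta$ belongs to $\mathcal{C}^\perp$ for every quaternary linear perfect code $\mathcal{C}$ (codes are considered up to coordinate permutation, not sign changes). *)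

theory Defs
  imports "HOL-Analysis.Finite_Cartesian_Product" "HOL-Algebra.Coset"
begin

text \<open>
  \<^typ>\<open>4\<close> and \<^typ>\<open>2\<close> are the rings of integers modulo 4 and modulo 2.  A vector of length
  \<open>\<beta>\<close> is indexed by a finite type \<open>'n\<close> with \<open>CARD('n) = \<beta>\<close>.
\<close>

definition z4_group :: "(4 ^ 'n) monoid" where
  "z4_group = \<lparr>carrier = UNIV, monoid.mult = (+), one = 0\<rparr>"

definition quaternary_linear_code :: "(4 ^ 'n) set \<Rightarrow> bool" where
  "quaternary_linear_code C \<longleftrightarrow> subgroup C z4_group"

definition dual_code :: "(4 ^ 'n) set \<Rightarrow> (4 ^ 'n) set" where
  "dual_code C = {u. \<forall>v\<in>C. (\<Sum>j\<in>UNIV. u $ j * v $ j) = 0}"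

definition gray :: "4 \<Rightarrow> 2 \<times> 2" where
  "gray a = (if a = 0 then (0, 0) else if a = 1 then (0, 1) else if a = 2 then (1, 1) else (1, 0))"

text \<open>
  The binary coordinates \<open>(i, 0)\<close> and \<open>(i, 1)\<close> hold the two bits of the image of the
  \<open>i\<close>-th quaternary coordinate, so the image has length \<open>2 \<beta>\<close>.
\<close>

definition gray_map :: "4 ^ 'n \<Rightarrow> 2 ^ ('n \<times> 2)" where
  "gray_map x = (\<chi> p. if snd p = 0 then fst (gray (x $ fst p)) else snd (gray (x $ fst p)))"

definition hamming_dist :: "'a ^ 'm \<Rightarrow> 'a ^ 'm \<Rightarrow> nat" where
  "hamming_dist x y = card {i. x $ i \<noteq> y $ i}"

definition min_dist :: "('a ^ 'm) set \<Rightarrow> nat" where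
  "min_dist B = Inf {hamming_dist x y | x y. x \<in> B \<and> y \<in> B \<and> x \<noteq> y}"

definition extended_perfect_parameters :: "nat \<Rightarrow> (2 ^ 'm) set \<Rightarrow> bool" where
  "extended_perfect_parameters t B \<longleftrightarrow>
     CARD('m) = 2 ^ t \<and> card B = 2 ^ (2 ^ t - t - 1) \<and> min_dist B = 4"

definition quaternary_linear_perfect_code :: "nat \<Rightarrow> (4 ^ 'n) set \<Rightarrow> bool" where
  "quaternary_linear_perfect_code t C \<longleftrightarrow>
     CARD('n) = 2 ^ (t - 1) \<and> quaternary_linear_code C \<and>
     extended_perfect_parameters t (gray_map ` C)"

definition intersection_number :: "(4 ^ 'n) set \<Rightarrow> (4 ^ 'n) set \<Rightarrow> nat" where
  "intersection_number C D = card (C \<inter> D)"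

end

theory Submission imports Defs
begin

text \<open>
  The lower bound is a counting argument: the differences \<open>x - y\<close> with \<open>x \<in> C\<^sub>1\<close> and \<open>y \<in> C\<^sub>2\<close> form
  a group of order \<open>|C\<^sub>1| |C\<^sub>2| / |C\<^sub>1 \<inter> C\<^sub>2|\<close>. It lies in the group of vectors with coordinate sum
  zero, because the all-ones vector is orthogonal to both codes, and that group has index 4.
\<close>

lemma card_mult_le_card_diff_mult_card_Int:
  fixes A B D :: "'a::ab_group_add set"
  assumes "finite A" "finite B" "finite D"
    and A: "\<And>x y. x \<in> A \<Longrightarrow> y \<in> A \<Longrightarrow> x - y \<in> A"
    and B: "\<And>x y. x \<in> B \<Longrightarrow> y \<in> B \<Longrightarrow> x - y \<in> B"
    and D: "\<And>x y. x \<in> A \<Longrightarrow> y \<in> B \<Longrightarrow> x - y \<in> D"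
  shows "card A * card B \<le> card D * card (A \<inter> B)"
proof -
  \<comment> \<open>\<open>r d\<close> fixes one way to write \<open>d\<close> as an element of
    \<open>A\<close> minus an element of \<open>B\<close>; when \<open>d = x - y\<close>, the
    element \<open>x\<close> itself witnesses that one exists.\<close>
  define r where "r d = (SOME x. x \<in> A \<and> x - d \<in> B)" for d
  have r: "r (x - y) \<in> A \<and> r (x - y) - (x - y) \<in> B" if "x \<in> A" "y \<in> B" for x y
    unfolding r_def by (rule someI[of _ x]) (use that in simp)
  \<comment> \<open>The first component determines \<open>r (x - y)\<close>, so the second recovers
    \<open>x\<close>, and then the first recovers \<open>y\<close>.\<close>
  let ?f = "\<lambda>(x, y). (x - y, x - r (x - y))"
  have "inj_on ?f (A \<times> B)"
    by (auto simp: inj_on_def)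
  moreover have "?f ` (A \<times> B) \<subseteq> D \<times> (A \<inter> B)"
  proof clarify
    fix x y assume xy: "x \<in> A" "y \<in> B"
    \<comment> \<open>The left side is a difference of elements of \<open>A\<close>, the right side
      one of elements of \<open>B\<close>, so the offset lies in both.\<close>
    have "x - r (x - y) = y - (r (x - y) - (x - y))" by simp
    with r[OF xy] xy A B D show "(x - y \<in> D) \<and> x - r (x - y) \<in> A \<inter> B"
      by (metis IntI)
  qed
  ultimately have "card (A \<times> B) \<le> card (D \<times> (A \<inter> B))"
    using assms by (intro card_inj_on_le) auto
  then show ?thesis by (simp add: card_cartesian_product)
qed

text \<open>Adding \<open>c\<close> in one fixed coordinate turns a vector of sum zero into one of
  sum \<open>c\<close>. The translates for distinct \<open>c\<close> are therefore disjoint copies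
  inside the whole space.\<close>

lemma card_sum_zero_le:
  "CARD('a) * card {v :: 'a::{finite,ab_group_add} ^ 'n. (\<Sum>j\<in>UNIV. v $ j) = 0}
    \<le> CARD('a) ^ CARD('n)"
proof -
  let ?H = "{v :: 'a ^ 'n. (\<Sum>j\<in>UNIV. v $ j) = 0}"
  define k :: 'n where "k = undefined"
  let ?f = "\<lambda>(c, v). v + axis k c :: 'a ^ 'n"
  have sum: "(\<Sum>j\<in>UNIV. (v + axis k c) $ j) = c" if "v \<in> ?H" for v :: "'a ^ 'n" and c
    using that by (simp add: sum.distrib axis_def)
  have "inj_on ?f (UNIV \<times> ?H)"
  proof (rule inj_onI, clarify)
    fix c d :: 'a and v w :: "'a ^ 'n"
    assume vw: "(\<Sum>j\<in>UNIV. v $ j) = 0" "(\<Sum>j\<in>UNIV. w $ j) = 0"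
      and eq: "v + axis k c = w + axis k d"
    then have "c = d" using sum[of v c] sum[of w d] by simp
    with eq show "c = d \<and> v = w" by simp
  qed
  then have "card ((UNIV :: 'a set) \<times> ?H) \<le> CARD('a ^ 'n)"
    by (rule card_inj_on_le) auto
  then show ?thesis by (simp add: card_cartesian_product)
qed

lemma inj_gray: "inj gray"
proof -
  have "x = 0 \<or> x = 1 \<or> x = 2 \<or> x = 3" for x :: 4
  proof (cases x rule: bit0_cases)
    case (of_int z)
    then have "z = 0 \<or> z = 1 \<or> z = 2 \<or> z = 3" by auto
    with of_int show ?thesis by auto
  qed
  then show ?thesis
    by (intro injI) (auto simp: gray_def split: if_splits)
qed

lemma inj_gray_map: "inj gray_map"
proof (rule injI)
  fix x y :: "4 ^ 'n"
  assume eq: "gray_map x = gray_map y"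
  have "gray (x $ i) = gray (y $ i)" for i
    using arg_cong[OF eq, of "\<lambda>v. v $ (i, 0)"] arg_cong[OF eq, of "\<lambda>v. v $ (i, 1)"]
    by (simp add: gray_map_def prod_eq_iff)
  then show "x = y"
    by (simp add: vec_eq_iff inj_eq[OF inj_gray])
qed

lemma quaternary_linear_code_diff:
  assumes "quaternary_linear_code C" "x \<in> C" "y \<in> C"
  shows "x - y \<in> C"
proof -
  interpret subgroup C z4_group
    using assms by (simp add: quaternary_linear_code_def)
  \<comment> \<open>Subgroup closure concerns the abstract inverse of \<open>z4_group\<close>, which
    has to be identified with \<open>- y\<close> by uniqueness of inverses.\<close>
  have "group (z4_group :: (4 ^ 'n) monoid)"
    by (rule groupI) (auto simp: z4_group_def add.assoc intro: exI[of _ "- _"])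
  moreover have "- y \<otimes>\<^bsub>z4_group\<^esub> y = \<one>\<^bsub>z4_group\<^esub>"
    by (simp add: z4_group_def)
  ultimately have "inv\<^bsub>z4_group\<^esub> y = - y"
    by (intro group.inv_equality) (auto simp: z4_group_def)
  with m_inv_closed[OF \<open>y \<in> C\<close>] have "x \<otimes>\<^bsub>z4_group\<^esub> - y \<in> C"
    using assms(2) by (simp add: m_closed)
  then show ?thesis by (simp add: z4_group_def)
qed

lemma sum_eq_0_of_ones_in_dual_code:
  assumes "(\<chi> j. 1) \<in> dual_code C" "v \<in> C"
  shows "(\<Sum>j\<in>UNIV. v $ j) = 0"
  using assms by (simp add: dual_code_def)

text \<open>The Gray map is injective, so the code is as large as its binary image. With
  \<open>t \<ge> 1\<close> the exponent \<open>t - 1\<close> is not truncated, which gives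
  \<open>2 ^ t = 2 * CARD('n)\<close>.\<close>

lemma card_quaternary_linear_perfect_code:
  assumes "quaternary_linear_perfect_code t (C :: (4 ^ 'n) set)" "t \<ge> 1"
  shows "card C = 2 ^ (2 * CARD('n) - t - 1)"
proof -
  have "2 ^ t = 2 * CARD('n)"
    using assms by (cases t) (auto simp: quaternary_linear_perfect_code_def)
  then show ?thesis
    using assms card_image[OF inj_on_subset[OF inj_gray_map], of C]
    by (simp add: quaternary_linear_perfect_code_def extended_perfect_parameters_def)
qed

theorem theorem4:
  fixes t :: nat and C1 C2 :: "(4 ^ 'n) set"
  assumes "t \<ge> 3"
    and "CARD('n) = 2 ^ (t - 1)"
    and "quaternary_linear_perfect_code t C1"
    and "quaternary_linear_perfect_code t C2"
    and "(\<chi> j. 1) \<in> dual_code C1"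
    and "(\<chi> j. 1) \<in> dual_code C2"
  shows "2 ^ (2 * CARD('n) - 2 * t) \<le> intersection_number C1 C2
       \<and> intersection_number C1 C2 \<le> 2 ^ (2 * CARD('n) - t - 1)"
proof
  let ?b = "CARD('n)"
  let ?H = "{v :: 4 ^ 'n. (\<Sum>j\<in>UNIV. v $ j) = 0}"
  let ?\<eta> = "card (C1 \<inter> C2)"
  have card: "card C1 = 2 ^ (2 * ?b - t - 1)" "card C2 = 2 ^ (2 * ?b - t - 1)"
    using assms(1) card_quaternary_linear_perfect_code[OF assms(3)]
      card_quaternary_linear_perfect_code[OF assms(4)] by auto
  show "intersection_number C1 C2 \<le> 2 ^ (2 * ?b - t - 1)"
    unfolding intersection_number_def card(1)[symmetric] by (rule card_mono) auto
  \<comment> \<open>This keeps the natural-number subtractions in the exponents from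
    truncating.\<close>
  have "t \<le> ?b"
    using assms(2) less_exp[of "t - 1"] by linarith
  then have b: "2 * (2 * ?b - t - 1) + 2 = 2 * ?b + (2 * ?b - 2 * t)"
    using assms(1) by simp
  \<comment> \<open>Both codes lie in \<open>?H\<close>, which is closed under differences, so
    \<open>?H\<close> can serve as the set \<open>D\<close>.\<close>
  have "card C1 * card C2 \<le> card ?H * ?\<eta>"
    by (rule card_mult_le_card_diff_mult_card_Int)
      (use assms in \<open>auto simp: quaternary_linear_perfect_code_def sum_subtractf
         quaternary_linear_code_diff sum_eq_0_of_ones_in_dual_code\<close>)
  \<comment> \<open>The factor 4 is the number of possible coordinate sums; it lets
    \<open>4 * card ?H\<close> be bounded by the size of the whole space.\<close>
  then have "4 * (card C1 * card C2) \<le> (4 * card ?H) * ?\<eta>"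
    by simp
  also have "\<dots> \<le> 4 ^ ?b * ?\<eta>"
    using card_sum_zero_le[where 'a = 4 and 'n = 'n] by (intro mult_right_mono) auto
  also have "(4::nat) ^ ?b = 2 ^ (2 * ?b)"
    by (simp add: power_mult)
  also have "4 * (card C1 * card C2) = 2 ^ (2 * (2 * ?b - t - 1) + 2)"
    unfolding card by (simp add: power_add mult_2)
  also have "\<dots> = 2 ^ (2 * ?b) * 2 ^ (2 * ?b - 2 * t)"
    unfolding b by (simp add: power_add)
  finally show "2 ^ (2 * ?b - 2 * t) \<le> intersection_number C1 C2"
    by (simp add: intersection_number_def)
qed

end
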